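(* Let $X\in\{A,B\}$, $Y\in\{A,B,-\}$, and let $\mathcal F$ be a family of graphs such that a graph is $[X,Y]$-perfect if and only if it contains no member of $\mathcal F$ as an induced subgraph. Then for every graph $G$ the following are equivalent: (1) $G$ is line $[X,Y]$-perfect; (2) no graph in $L^{-1}(\mathcal F)$ is an edge-induced subgraph of $G$; (3) no graph in $L^{-1}(\mathrm{red}(\mathcal F))$ is an edge-induced subgraph of $G$.
   Context: All graphs are finite and simple. Vertex game: in the $[X,Y]$-colouring game with $k$ colours on a graph $H$, Alice (A) and Bob (B) alternately colour an uncoloured vertex with one of $k$ colours so that adjacent vertices get distinct colours; player $X$ moves first; if $Y\in\{A,B\}$ only player $Y$ may skip moves, if $Y=-$ nobody may skip; the game ends when no move is possible, and Alice wins iff all vertices are coloured. $\chi_{[X,Y]}(H)$ is the least $k$ for which Alice has a winning strategy; $H$ is $[X,Y]$-perfect if $\chi_{[X,Y]}(H')=\omega(H')$ for every induced subgraph $H'$ of $H$ ($\omega$ = clique number). The $[X,Y]$-edge colouring game is defined identically but colouring edges, adjacent meaning sharing an endpoint; $\chi'_{[X,Y]}(G)$ is its least winning number of colours. An edge-induced subgraph of $G$ is a subgraph formed by a subset of edges together with their endpoints. $G$ is line $[X,Y]$-perfect if $\chi'_{[X,Y]}(H)=\omega(L(H))$ for every edge-induced subgraph $H$ of $G$, where $L(H)$ is the line graph. A graph is iso-free if it has no isolated vertices. For a family $\mathcal F$, $L^{-1}(\mathcal F)$ is the set of all iso-free graphs $H$ with $L(H)\in\mathcal F$ (up to isomorphism),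 and $\mathrm{red}(\mathcal F)$ is the set of members of $\mathcal F$ containing none of Beineke's nine forbidden induced subgraphs $N_1,\dots,N_9$ for line graphs (equivalently, by Beineke's theorem, the members of $\mathcal F$ that are line graphs). *)

theory Defs
  imports Main
begin

section \<open>Finite simple graphs\<close>

datatype 'a ugraph = UGraph (verts: "'a set") (edges: "'a set set")

definition simple_graph :: "'a ugraph \<Rightarrow> bool" where
  "simple_graph G \<longleftrightarrow> finite (verts G) \<and> (\<forall>e\<in>edges G. e \<subseteq> verts G \<and> card e = 2)"

definition graph_iso :: "'a ugraph \<Rightarrow> 'b ugraph \<Rightarrow> bool" where
  "graph_iso G H \<longleftrightarrow>
     (\<exists>f. bij_betw f (verts G) (verts H) \<and>
          (\<forall>u\<in>verts G. \<forall>v\<in>verts G. {u, v} \<in> edges G \<longleftrightarrow> {f u, f v} \<in> edges H))"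

definition induced_subgraph :: "'a ugraph \<Rightarrow> 'a set \<Rightarrow> 'a ugraph" where
  "induced_subgraph G S = UGraph S {e \<in> edges G. e \<subseteq> S}"

definition edge_induced_subgraph :: "'a set set \<Rightarrow> 'a ugraph" where
  "edge_induced_subgraph D = UGraph (\<Union>D) D"

text \<open>Containment is up to isomorphism, so the two graphs may have different vertex types.\<close>

definition contains_induced :: "'a ugraph \<Rightarrow> 'b ugraph \<Rightarrow> bool" where
  "contains_induced G M \<longleftrightarrow> (\<exists>S\<subseteq>verts G. graph_iso (induced_subgraph G S) M)"

definition contains_edge_induced :: "'a ugraph \<Rightarrow> 'b ugraph \<Rightarrow> bool" where
  "contains_edge_induced G M \<longleftrightarrow> (\<exists>D\<subseteq>edges G. graph_iso (edge_induced_subgraph D) M)"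

definition iso_free :: "'a ugraph \<Rightarrow> bool" where
  "iso_free G \<longleftrightarrow> (\<forall>v\<in>verts G. \<exists>e\<in>edges G. v \<in> e)"

definition edge_adj :: "'a set \<Rightarrow> 'a set \<Rightarrow> bool" where
  "edge_adj e f \<longleftrightarrow> e \<noteq> f \<and> e \<inter> f \<noteq> {}"

definition line_graph :: "'a ugraph \<Rightarrow> 'a set ugraph" where
  "line_graph G = UGraph (edges G) {{e, f} | e f. e \<in> edges G \<and> f \<in> edges G \<and> edge_adj e f}"

definition clique :: "'a ugraph \<Rightarrow> 'a set \<Rightarrow> bool" where
  "clique G K \<longleftrightarrow> K \<subseteq> verts G \<and> (\<forall>u\<in>K. \<forall>v\<in>K. u \<noteq> v \<longrightarrow> {u, v} \<in> edges G)"

definition clique_number :: "'a ugraph \<Rightarrow> nat" where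
  "clique_number G = Max {card K | K. clique G K}"

section \<open>The colouring games\<close>

datatype player = Alice | Bob

primrec opponent :: "player \<Rightarrow> player" where
  "opponent Alice = Bob"
| "opponent Bob = Alice"

text \<open>
  The vertex game and the edge game are the same game, played on a set \<open>W\<close> of objects with
  adjacency relation \<open>adj\<close>, using the colours \<open>{..<k}\<close>. A position is the list of the moves
  made so far, latest move first. \<open>X\<close> is the player who begins; \<open>Y = Some p\<close> means that
  only \<open>p\<close> may skip, \<open>Y = None\<close> (written \<open>-\<close> in the literature) that nobody may.
\<close>

datatype 'v move = Skip | Colour 'v nat

primrec colouring :: "'v move list \<Rightarrow> 'v \<Rightarrow> nat option" where
  "colouring [] = Map.empty"
| "colouring (m # h) =
     (case m of Skip \<Rightarrow> colouring h | Colour v i \<Rightarrow> (colouring h)(v \<mapsto> i))"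

definition to_move :: "player \<Rightarrow> 'v move list \<Rightarrow> player" where
  "to_move X h = (if even (length h) then X else opponent X)"

definition can_colour ::
  "nat \<Rightarrow> 'v set \<Rightarrow> ('v \<Rightarrow> 'v \<Rightarrow> bool) \<Rightarrow> 'v move list \<Rightarrow> 'v \<Rightarrow> nat \<Rightarrow> bool" where
  "can_colour k W adj h v i \<longleftrightarrow>
     v \<in> W \<and> colouring h v = None \<and> i < k \<and> (\<forall>w\<in>W. adj v w \<longrightarrow> colouring h w \<noteq> Some i)"

text \<open>
  Skipping does not prolong a game in which nothing can be coloured any more. Every play is
  therefore finite: the player without the right to skip has to colour at each turn.
\<close>

definition game_over :: "nat \<Rightarrow> 'v set \<Rightarrow> ('v \<Rightarrow> 'v \<Rightarrow> bool) \<Rightarrow> 'v move list \<Rightarrow> bool" where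
  "game_over k W adj h \<longleftrightarrow> (\<forall>v i. \<not> can_colour k W adj h v i)"

definition legal_move ::
  "player \<Rightarrow> player option \<Rightarrow> nat \<Rightarrow> 'v set \<Rightarrow> ('v \<Rightarrow> 'v \<Rightarrow> bool) \<Rightarrow> 'v move list \<Rightarrow> 'v move \<Rightarrow> bool"
where
  "legal_move X Y k W adj h m \<longleftrightarrow>
     (case m of
        Skip \<Rightarrow> Y = Some (to_move X h) \<and> \<not> game_over k W adj h
      | Colour v i \<Rightarrow> can_colour k W adj h v i)"

text \<open>The positions that can arise when Alice follows the strategy \<open>\<sigma>\<close>.\<close>

inductive consistent ::
  "player \<Rightarrow> player option \<Rightarrow> nat \<Rightarrow> 'v set \<Rightarrow> ('v \<Rightarrow> 'v \<Rightarrow> bool) \<Rightarrow>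
     ('v move list \<Rightarrow> 'v move) \<Rightarrow> 'v move list \<Rightarrow> bool"
  for X Y k W adj \<sigma>
where
  start: "consistent X Y k W adj \<sigma> []"
| step: "\<lbrakk>consistent X Y k W adj \<sigma> h; legal_move X Y k W adj h m;
          to_move X h = Alice \<Longrightarrow> m = \<sigma> h\<rbrakk>
         \<Longrightarrow> consistent X Y k W adj \<sigma> (m # h)"

definition winning_strategy ::
  "player \<Rightarrow> player option \<Rightarrow> nat \<Rightarrow> 'v set \<Rightarrow> ('v \<Rightarrow> 'v \<Rightarrow> bool) \<Rightarrow>
     ('v move list \<Rightarrow> 'v move) \<Rightarrow> bool"
where
  "winning_strategy X Y k W adj \<sigma> \<longleftrightarrow>
     (\<forall>h. consistent X Y k W adj \<sigma> h \<longrightarrow>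
        (if game_over k W adj h then \<forall>v\<in>W. colouring h v \<noteq> None
         else to_move X h = Alice \<longrightarrow> legal_move X Y k W adj h (\<sigma> h)))"

definition game_number ::
  "player \<Rightarrow> player option \<Rightarrow> 'v set \<Rightarrow> ('v \<Rightarrow> 'v \<Rightarrow> bool) \<Rightarrow> nat" where
  "game_number X Y W adj = (LEAST k. \<exists>\<sigma>. winning_strategy X Y k W adj \<sigma>)"

definition game_chromatic_number :: "player \<Rightarrow> player option \<Rightarrow> 'a ugraph \<Rightarrow> nat" where
  "game_chromatic_number X Y H = game_number X Y (verts H) (\<lambda>u v. {u, v} \<in> edges H)"

definition game_chromatic_index :: "player \<Rightarrow> player option \<Rightarrow> 'a ugraph \<Rightarrow> nat" where
  "game_chromatic_index X Y G = game_number X Y (edges G) edge_adj"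

definition game_perfect :: "player \<Rightarrow> player option \<Rightarrow> 'a ugraph \<Rightarrow> bool" where
  "game_perfect X Y H \<longleftrightarrow>
     (\<forall>S\<subseteq>verts H. game_chromatic_number X Y (induced_subgraph H S)
                     = clique_number (induced_subgraph H S))"

definition line_game_perfect :: "player \<Rightarrow> player option \<Rightarrow> 'a ugraph \<Rightarrow> bool" where
  "line_game_perfect X Y G \<longleftrightarrow>
     (\<forall>D\<subseteq>edges G. game_chromatic_index X Y (edge_induced_subgraph D)
                     = clique_number (line_graph (edge_induced_subgraph D)))"

section \<open>Families of graphs\<close>

text \<open>
  Families are considered up to isomorphism, and every finite graph is isomorphic to one whose
  vertices are natural numbers; so a family is a set of graphs on \<open>nat\<close>.
\<close>

definition line_preimage :: "nat ugraph set \<Rightarrow> nat ugraph set" where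
  "line_preimage F =
     {H. simple_graph H \<and> iso_free H \<and> (\<exists>M\<in>F. graph_iso (line_graph H) M)}"

definition mk_graph :: "nat \<Rightarrow> (nat \<times> nat) list \<Rightarrow> nat ugraph" where
  "mk_graph n es = UGraph {..<n} {{a, b} | a b. (a, b) \<in> set es}"

text \<open>
  Beineke's nine forbidden induced subgraphs for line graphs. The diamond is the complete
  graph on 0, 1, 2, 3 minus the edge between 2 and 3.
\<close>

definition beineke_graphs :: "nat ugraph set" where
  "beineke_graphs =
    {
     \<comment> \<open>the claw\<close>
     mk_graph 4 [(0,1), (0,2), (0,3)],
     \<comment> \<open>the complete graph on 5 vertices minus an edge\<close>
     mk_graph 5 [(0,1), (0,2), (0,3), (0,4), (1,2), (1,3), (1,4), (2,3), (2,4)],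
     \<comment> \<open>diamond, with a vertex joined to both of its vertices of degree 2\<close>
     mk_graph 5 [(0,1), (0,2), (0,3), (1,2), (1,3), (2,4), (3,4)],
     \<comment> \<open>diamond, with a pendant vertex at each of its vertices of degree 2\<close>
     mk_graph 6 [(0,1), (0,2), (0,3), (1,2), (1,3), (2,4), (3,5)],
     \<comment> \<open>diamond, with its vertices of degree 2 joined by a further path of length 3\<close>
     mk_graph 6 [(0,1), (0,2), (0,3), (1,2), (1,3), (2,4), (3,5), (4,5)],
     \<comment> \<open>the square of the path 4, 2, 0, 1, 3, 5\<close>
     mk_graph 6 [(0,1), (0,2), (0,3), (0,4), (1,2), (1,3), (1,5), (2,4), (3,5)],
     \<comment> \<open>complete graph on 4 vertices, with 4 joined to 0 and 1, and 5 pendant at 4\<close>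
     mk_graph 6 [(0,1), (0,2), (0,3), (0,4), (1,2), (1,3), (1,4), (2,3), (4,5)],
     \<comment> \<open>two complete graphs on 4 vertices sharing an edge\<close>
     mk_graph 6 [(0,1), (0,2), (0,3), (0,4), (0,5), (1,2), (1,3), (1,4), (1,5), (2,3), (4,5)],
     \<comment> \<open>the wheel with five spokes\<close>
     mk_graph 6 [(0,1), (0,2), (0,3), (0,4), (0,5), (1,2), (1,3), (2,4), (3,5), (4,5)]
    }"

definition red :: "nat ugraph set \<Rightarrow> nat ugraph set" where
  "red F = {M \<in> F. \<forall>N\<in>beineke_graphs. \<not> contains_induced M N}"

end

(* Colouring the edges of G is colouring the vertices of its line graph, and the edge-induced
   subgraphs of G correspond to the induced subgraphs of L(G); so G is line perfect iff L(G) is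
   perfect, i.e. iff L(G) contains no member of F. A member of F inside L(G) is the line graph of an
   edge-induced subgraph of G. Passing to red F changes nothing, because the nine graphs are not
   induced subgraphs of line graphs. *)

theory Submission
  imports Defs
begin

section \<open>Isomorphisms\<close>

text \<open>Names the map that \<open>graph_iso\<close> hides under an existential quantifier, so
  that the same witness can be restricted to induced subgraphs and applied to cliques and
  plays.\<close>

definition isomorphism :: "('a \<Rightarrow> 'b) \<Rightarrow> 'a ugraph \<Rightarrow> 'b ugraph \<Rightarrow> bool" where
  "isomorphism f G H \<longleftrightarrow>
     bij_betw f (verts G) (verts H) \<and>
     (\<forall>u\<in>verts G. \<forall>v\<in>verts G. {u, v} \<in> edges G \<longleftrightarrow> {f u, f v} \<in> edges H)"

lemma graph_iso_altdef: "graph_iso G H \<longleftrightarrow> (\<exists>f. isomorphism f G H)"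
  by (simp add: graph_iso_def isomorphism_def)

lemma isomorphism_inv_into:
  assumes "isomorphism f G H"
  shows "isomorphism (inv_into (verts G) f) H G"
proof -
  have bij: "bij_betw f (verts G) (verts H)"
    and adj: "\<And>u v. u \<in> verts G \<Longrightarrow> v \<in> verts G \<Longrightarrow> {u, v} \<in> edges G \<longleftrightarrow> {f u, f v} \<in> edges H"
    using assms by (auto simp: isomorphism_def)
  have "inv_into (verts G) f x \<in> verts G" "f (inv_into (verts G) f x) = x" if "x \<in> verts H" for x
    using bij that by (auto simp: bij_betw_def inv_into_into f_inv_into_f)
  then show ?thesis
    using adj bij by (auto simp: isomorphism_def bij_betw_inv_into)
qed

lemma graph_iso_sym: "graph_iso G H \<Longrightarrow> graph_iso H G"
  using isomorphism_inv_into by (auto simp: graph_iso_altdef)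

lemma graph_iso_trans:
  assumes "graph_iso G H" and "graph_iso H K"
  shows "graph_iso G K"
proof -
  from assms obtain f g where f: "isomorphism f G H" and g: "isomorphism g H K"
    by (auto simp: graph_iso_altdef)
  then have "bij_betw (g \<circ> f) (verts G) (verts K)"
    by (auto simp: isomorphism_def intro: bij_betw_trans)
  moreover have "f u \<in> verts H" if "u \<in> verts G" for u
    using f that by (auto simp: isomorphism_def bij_betw_def)
  ultimately have "isomorphism (g \<circ> f) G K"
    using f g by (auto simp: isomorphism_def)
  then show ?thesis
    by (auto simp: graph_iso_altdef)
qed

lemma verts_induced_subgraph [simp]: "verts (induced_subgraph G S) = S"
  by (simp add: induced_subgraph_def)

lemma edges_induced_subgraph [simp]: "edges (induced_subgraph G S) = {e \<in> edges G. e \<subseteq> S}"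
  by (simp add: induced_subgraph_def)

lemma isomorphism_induced_subgraph:
  assumes "isomorphism f G H" and "S \<subseteq> verts G"
  shows "isomorphism f (induced_subgraph G S) (induced_subgraph H (f ` S))"
  using assms by (auto simp: isomorphism_def bij_betw_def intro: inj_on_subset)

lemma contains_induced_isoI:
  assumes "graph_iso G H" and "contains_induced G M"
  shows "contains_induced H M"
proof -
  from assms obtain f S where f: "isomorphism f G H" and S: "S \<subseteq> verts G"
    and M: "graph_iso (induced_subgraph G S) M"
    by (auto simp: graph_iso_altdef contains_induced_def)
  have "graph_iso (induced_subgraph H (f ` S)) (induced_subgraph G S)"
    using isomorphism_induced_subgraph[OF f S] graph_iso_sym by (auto simp: graph_iso_altdef)
  then have "graph_iso (induced_subgraph H (f ` S)) M"
    using M by (rule graph_iso_trans)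
  moreover have "f ` S \<subseteq> verts H"
    using f S by (auto simp: isomorphism_def bij_betw_def)
  ultimately show ?thesis
    by (auto simp: contains_induced_def)
qed

lemma contains_induced_iso: "graph_iso G H \<Longrightarrow> contains_induced G M \<longleftrightarrow> contains_induced H M"
  using contains_induced_isoI graph_iso_sym by metis

lemma clique_image:
  assumes "isomorphism f G H" and "clique G K"
  shows "clique H (f ` K)" and "card (f ` K) = card K"
proof -
  have K: "K \<subseteq> verts G" and inj: "inj_on f (verts G)" and img: "f ` verts G = verts H"
    using assms by (auto simp: clique_def isomorphism_def bij_betw_def)
  show "card (f ` K) = card K"
    using inj K by (auto intro: card_image inj_on_subset)
  have "{f u, f v} \<in> edges H" if "u \<in> K" "v \<in> K" "f u \<noteq> f v" for u v
  proof -
    have "u \<in> verts G" "v \<in> verts G" "{u, v} \<in> edges G"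
      using assms(2) that by (auto simp: clique_def)
    then show ?thesis
      using assms(1) by (auto simp: isomorphism_def)
  qed
  then show "clique H (f ` K)"
    using K by (auto simp: clique_def simp flip: img)
qed

text \<open>Cliques can be transported both ways without changing their size, so the two sets under
  \<open>Max\<close> are equal.\<close>

lemma clique_number_iso:
  assumes "graph_iso G H"
  shows "clique_number G = clique_number H"
proof -
  have sub: "{card K | K. clique A K} \<subseteq> {card K | K. clique B K}"
    if "graph_iso A B" for A :: "'c ugraph" and B :: "'d ugraph"
    using that clique_image unfolding graph_iso_altdef by (smt (verit) mem_Collect_eq subsetI)
  show ?thesis
    unfolding clique_number_def
    using sub[OF assms] sub[OF graph_iso_sym[OF assms]] by simp
qed

section \<open>The game number is invariant under isomorphism\<close>

fun map_play :: "('v \<Rightarrow> 'w) \<Rightarrow> 'v move \<Rightarrow> 'w move" where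
  "map_play f Skip = Skip"
| "map_play f (Colour v i) = Colour (f v) i"

text \<open>The map between two boards is injective only on \<open>W\<close>, so a history can be
  transported faithfully only if all its moves stay on the board. Plays consisting of legal moves
  do.\<close>

fun in_board :: "'v set \<Rightarrow> 'v move \<Rightarrow> bool" where
  "in_board W Skip \<longleftrightarrow> True"
| "in_board W (Colour v i) \<longleftrightarrow> v \<in> W"

lemma legal_move_in_board: "legal_move X Y k W adj h m \<Longrightarrow> in_board W m"
  by (cases m) (auto simp: legal_move_def can_colour_def)

lemma consistent_in_board:
  "consistent X Y k W adj \<sigma> h \<Longrightarrow> \<forall>m\<in>set h. in_board W m"
  by (induction rule: consistent.induct) (auto dest: legal_move_in_board)

lemma to_move_map [simp]: "to_move X (map f h) = to_move X h"
  by (simp add: to_move_def)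

text \<open>Phrased for arbitrary boards rather than graphs, so that it covers both an isomorphism
  of graphs and the passage from edges with \<open>edge_adj\<close> to the vertices of the line
  graph.\<close>

locale board_iso =
  fixes W :: "'v set" and adj :: "'v \<Rightarrow> 'v \<Rightarrow> bool"
    and W' :: "'w set" and adj' :: "'w \<Rightarrow> 'w \<Rightarrow> bool" and f :: "'v \<Rightarrow> 'w"
  assumes bij: "bij_betw f W W'"
    and adj_iff: "u \<in> W \<Longrightarrow> v \<in> W \<Longrightarrow> adj u v \<longleftrightarrow> adj' (f u) (f v)"
begin

lemma inj: "inj_on f W" and image: "f ` W = W'"
  using bij by (auto simp: bij_betw_def)

lemma colouring_map:
  assumes "\<forall>m\<in>set h. in_board W m" and "v \<in> W"
  shows "colouring (map (map_play f) h) (f v) = colouring h v"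
  using assms(1)
proof (induction h)
  case (Cons m h)
  then show ?case
    using inj assms(2) by (cases m) (auto simp: inj_on_eq_iff)
qed simp

lemma can_colour_map:
  assumes "\<forall>m\<in>set h. in_board W m" and "v \<in> W"
  shows "can_colour k W' adj' (map (map_play f) h) (f v) i \<longleftrightarrow> can_colour k W adj h v i"
  using assms by (auto simp: can_colour_def colouring_map adj_iff simp flip: image)

lemma game_over_map:
  assumes "\<forall>m\<in>set h. in_board W m"
  shows "game_over k W' adj' (map (map_play f) h) \<longleftrightarrow> game_over k W adj h"
proof -
  have "game_over k W' adj' (map (map_play f) h) \<longleftrightarrow>
          (\<forall>v\<in>W. \<forall>i. \<not> can_colour k W' adj' (map (map_play f) h) (f v) i)"
    by (auto simp: game_over_def can_colour_def simp flip: image)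
  also have "\<dots> \<longleftrightarrow> (\<forall>v\<in>W. \<forall>i. \<not> can_colour k W adj h v i)"
    using assms by (simp add: can_colour_map)
  also have "\<dots> \<longleftrightarrow> game_over k W adj h"
    by (auto simp: game_over_def can_colour_def)
  finally show ?thesis .
qed

lemma legal_move_map:
  assumes "\<forall>m\<in>set h. in_board W m" and "in_board W m"
  shows "legal_move X Y k W' adj' (map (map_play f) h) (map_play f m) \<longleftrightarrow>
           legal_move X Y k W adj h m"
  using assms by (cases m) (auto simp: legal_move_def can_colour_map game_over_map)

lemma map_play_inverse:
  assumes "in_board W' m"
  shows "map_play f (map_play (inv_into W f) m) = m" and "in_board W (map_play (inv_into W f) m)"
  using assms by (cases m; auto simp: f_inv_into_f inv_into_into simp flip: image)+

lemma map_map_play_inverse: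
  "\<forall>m\<in>set h. in_board W' m \<Longrightarrow> map (map_play f) (map (map_play (inv_into W f)) h) = h"
  by (induction h) (simp_all add: map_play_inverse)

text \<open>Alice plays on \<open>W'\<close> by pulling the history back to \<open>W\<close>,
  consulting \<open>\<sigma>\<close> there and pushing its answer forward. This wins because every
  play that follows the new strategy pulls back to a play that follows
  \<open>\<sigma>\<close>.\<close>

lemma winning_strategy_map:
  assumes \<sigma>: "winning_strategy X Y k W adj \<sigma>"
  shows "winning_strategy X Y k W' adj'
           (\<lambda>h. map_play f (\<sigma> (map (map_play (inv_into W f)) h)))"
    (is "winning_strategy X Y k W' adj' ?\<sigma>'")
proof -
  let ?back = "map (map_play (inv_into W f))"
  have back_board: "\<forall>m\<in>set (?back h). in_board W m" if "\<forall>m\<in>set h. in_board W' m" for h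
    using that by (auto simp: map_play_inverse)
  have back_over: "game_over k W' adj' h \<longleftrightarrow> game_over k W adj (?back h)"
    if "\<forall>m\<in>set h. in_board W' m" for h
    using game_over_map[OF back_board[OF that]] map_map_play_inverse[OF that] by simp
  have back_legal: "legal_move X Y k W' adj' h (map_play f m) \<longleftrightarrow> legal_move X Y k W adj (?back h) m"
    if "\<forall>m\<in>set h. in_board W' m" "in_board W m" for h m
    using legal_move_map[OF back_board[OF that(1)] that(2)] map_map_play_inverse[OF that(1)] by simp
  have sigma_legal: "legal_move X Y k W adj h (\<sigma> h)"
    if "consistent X Y k W adj \<sigma> h" "\<not> game_over k W adj h" "to_move X h = Alice" for h
    using \<sigma> that by (auto simp: winning_strategy_def)
  have back_consistent: "consistent X Y k W adj \<sigma> (?back h)"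
    if "consistent X Y k W' adj' ?\<sigma>' h" for h
    using that
  proof (induction rule: consistent.induct)
    case start
    show ?case by (simp add: consistent.start)
  next
    case (step h m)
    have h: "\<forall>m\<in>set h. in_board W' m"
      using step.hyps(1) by (rule consistent_in_board)
    have m: "in_board W' m"
      using step.hyps(2) by (rule legal_move_in_board)
    have legal: "legal_move X Y k W adj (?back h) (map_play (inv_into W f) m)"
      using back_legal[OF h map_play_inverse(2)[OF m]] step.hyps(2) map_play_inverse(1)[OF m] by simp
    have "map_play (inv_into W f) m = \<sigma> (?back h)" if Alice: "to_move X h = Alice"
    proof -
      \<comment> \<open>The pulled-back move is legal, and neither a skip nor a colouring move is
        legal once the game is over. Hence the winning strategy \<open>\<sigma>\<close> gives a
        legal answer here; it lies on the board, where \<open>inv_into W f\<close> undoes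
        \<open>f\<close>.\<close>
      have "\<not> game_over k W adj (?back h)"
        using legal by (auto simp: legal_move_def game_over_def split: move.splits)
      then have "in_board W (\<sigma> (?back h))"
        using sigma_legal[OF step.IH] Alice by (auto intro: legal_move_in_board)
      moreover have "m = map_play f (\<sigma> (?back h))"
        using step.hyps(3) Alice by simp
      ultimately show ?thesis
        using inj by (cases "\<sigma> (?back h)") auto
    qed
    then show ?case
      using legal step.IH by (auto intro: consistent.step)
  qed
  show ?thesis
    unfolding winning_strategy_def
  proof (intro allI impI)
    fix h assume h: "consistent X Y k W' adj' ?\<sigma>' h"
    note board = consistent_in_board[OF h]
    note pulled = back_consistent[OF h]
    show "if game_over k W' adj' h then \<forall>v\<in>W'. colouring h v \<noteq> None
          else to_move X h = Alice \<longrightarrow> legal_move X Y k W' adj' h (?\<sigma>' h)"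
    proof (cases "game_over k W' adj' h")
      case True
      then have "\<forall>v\<in>W. colouring (?back h) v \<noteq> None"
        using \<sigma> pulled back_over[OF board] by (auto simp: winning_strategy_def)
      then have "\<forall>v\<in>W. colouring h (f v) \<noteq> None"
        using colouring_map[OF back_board[OF board]] map_map_play_inverse[OF board] by simp
      then show ?thesis
        using True by (auto simp flip: image)
    next
      case False
      have "legal_move X Y k W' adj' h (?\<sigma>' h)" if "to_move X h = Alice"
      proof -
        have "legal_move X Y k W adj (?back h) (\<sigma> (?back h))"
          using sigma_legal[OF pulled] False that back_over[OF board] by simp
        then show ?thesis
          using back_legal[OF board] legal_move_in_board by blast
      qed
      then show ?thesis
        using False by simp
    qed
  qed
qed

lemma board_iso_inv_into: "board_iso W' adj' W adj (inv_into W f)"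
proof
  show "bij_betw (inv_into W f) W' W"
    using bij by (rule bij_betw_inv_into)
  fix u v assume "u \<in> W'" "v \<in> W'"
  then show "adj' u v \<longleftrightarrow> adj (inv_into W f u) (inv_into W f v)"
    by (auto simp: adj_iff inv_into_into f_inv_into_f simp flip: image)
qed

text \<open>For each \<open>k\<close>, strategies transfer in both directions; thus both
  \<open>LEAST\<close> operators are applied to the same predicate.\<close>

lemma game_number_eq: "game_number X Y W adj = game_number X Y W' adj'"
proof -
  have "(\<exists>\<sigma>. winning_strategy X Y k W adj \<sigma>) \<longleftrightarrow> (\<exists>\<sigma>. winning_strategy X Y k W' adj' \<sigma>)" for k
    using winning_strategy_map board_iso.winning_strategy_map[OF board_iso_inv_into] by blast
  then show ?thesis
    by (simp add: game_number_def)
qed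

end

section \<open>Invariance of the game chromatic number and of perfectness\<close>

lemma game_chromatic_number_iso:
  assumes "graph_iso G H"
  shows "game_chromatic_number X Y G = game_chromatic_number X Y H"
proof -
  obtain f where "isomorphism f G H"
    using assms by (auto simp: graph_iso_altdef)
  then interpret board_iso "verts G" "\<lambda>u v. {u, v} \<in> edges G" "verts H" "\<lambda>u v. {u, v} \<in> edges H" f
    by unfold_locales (auto simp: isomorphism_def)
  show ?thesis
    unfolding game_chromatic_number_def by (rule game_number_eq)
qed

lemma game_perfect_isoI:
  assumes "graph_iso G H" and "game_perfect X Y G"
  shows "game_perfect X Y H"
  unfolding game_perfect_def
proof (intro allI impI)
  fix S assume S: "S \<subseteq> verts H"
  obtain f where f: "isomorphism f H G"
    using graph_iso_sym[OF assms(1)] by (auto simp: graph_iso_altdef)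
  have iso: "graph_iso (induced_subgraph H S) (induced_subgraph G (f ` S))"
    using isomorphism_induced_subgraph[OF f S] by (auto simp: graph_iso_altdef)
  have "f ` S \<subseteq> verts G"
    using f S by (auto simp: isomorphism_def bij_betw_def)
  then show "game_chromatic_number X Y (induced_subgraph H S) = clique_number (induced_subgraph H S)"
    using assms(2) game_chromatic_number_iso[OF iso] clique_number_iso[OF iso]
    by (simp add: game_perfect_def)
qed

lemma game_perfect_iso: "graph_iso G H \<Longrightarrow> game_perfect X Y G \<longleftrightarrow> game_perfect X Y H"
  using game_perfect_isoI graph_iso_sym by metis

section \<open>Line graphs\<close>

lemma verts_line_graph [simp]: "verts (line_graph G) = edges G"
  by (simp add: line_graph_def)

lemma edge_adj_commute: "edge_adj e f \<longleftrightarrow> edge_adj f e"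
  by (auto simp: edge_adj_def)

lemma edges_line_graph_iff:
  "{e, f} \<in> edges (line_graph G) \<longleftrightarrow> e \<in> edges G \<and> f \<in> edges G \<and> edge_adj e f"
  by (auto simp: line_graph_def doubleton_eq_iff edge_adj_commute)

lemma verts_edge_induced_subgraph [simp]: "verts (edge_induced_subgraph D) = \<Union>D"
  and edges_edge_induced_subgraph [simp]: "edges (edge_induced_subgraph D) = D"
  by (simp_all add: edge_induced_subgraph_def)

text \<open>An equality, not just an isomorphism: the vertices of a line graph are the edges
  themselves, and whether two of them are adjacent does not depend on the surrounding graph.\<close>

lemma line_graph_edge_induced_subgraph:
  assumes "D \<subseteq> edges G"
  shows "line_graph (edge_induced_subgraph D) = induced_subgraph (line_graph G) D"
  using assms by (auto simp: line_graph_def induced_subgraph_def)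

lemma game_chromatic_index_line_graph:
  "game_chromatic_index X Y G = game_chromatic_number X Y (line_graph G)"
proof -
  interpret board_iso "edges G" edge_adj "edges G" "\<lambda>e f. {e, f} \<in> edges (line_graph G)" id
    by unfold_locales (auto simp: edges_line_graph_iff)
  show ?thesis
    by (simp add: game_chromatic_index_def game_chromatic_number_def game_number_eq)
qed

text \<open>The sets \<open>D\<close> of edges of \<open>G\<close> are exactly the sets of vertices
  of its line graph, so both notions quantify over the same sets and compare the same
  numbers.\<close>

lemma line_game_perfect_iff: "line_game_perfect X Y G \<longleftrightarrow> game_perfect X Y (line_graph G)"
  by (simp add: line_game_perfect_def game_perfect_def game_chromatic_index_line_graph
      line_graph_edge_induced_subgraph)

section \<open>Isomorphic copies, and containment in a line graph\<close>

lemma simple_graph_edgeE: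
  assumes "simple_graph G" and "e \<in> edges G"
  obtains u v where "e = {u, v}" "u \<in> verts G" "v \<in> verts G"
  using assms by (force simp: simple_graph_def card_2_iff)

lemma simple_graph_finite_edges: "simple_graph G \<Longrightarrow> finite (edges G)"
  by (rule finite_subset[of _ "Pow (verts G)"]) (auto simp: simple_graph_def)

lemma simple_graph_line_graph: "simple_graph G \<Longrightarrow> simple_graph (line_graph G)"
  by (auto simp: simple_graph_def[of "line_graph G"] simple_graph_finite_edges)
    (auto simp: line_graph_def edge_adj_def card_2_iff)

lemma simple_graph_edge_induced_subgraph:
  assumes "simple_graph G" and "D \<subseteq> edges G"
  shows "simple_graph (edge_induced_subgraph D)"
proof -
  have "\<Union>D \<subseteq> verts G"
    using assms by (auto simp: simple_graph_def)
  then show ?thesis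
    using assms by (auto simp: simple_graph_def intro: finite_subset)
qed

text \<open>The isomorphism sends an edge to its image under \<open>f\<close>. Simplicity makes
  every edge a pair of vertices, the only kind of set that \<open>graph_iso\<close>
  compares.\<close>

lemma line_graph_iso:
  assumes "simple_graph G" and "simple_graph H" and "graph_iso G H"
  shows "graph_iso (line_graph G) (line_graph H)"
proof -
  obtain f where inj: "inj_on f (verts G)" and img: "f ` verts G = verts H"
    and adj: "\<And>u v. u \<in> verts G \<Longrightarrow> v \<in> verts G \<Longrightarrow> {u, v} \<in> edges G \<longleftrightarrow> {f u, f v} \<in> edges H"
    using assms(3) by (auto simp: graph_iso_def bij_betw_def)
  have sub: "edges G \<subseteq> Pow (verts G)"
    using assms(1) by (auto simp: simple_graph_def)
  have inj': "inj_on ((`) f) (edges G)"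
    using inj_on_subset[OF inj_on_image_Pow[OF inj] sub] .
  have "f ` e \<in> edges H" if "e \<in> edges G" for e
    using assms(1) that by (rule simple_graph_edgeE) (use adj that in auto)
  moreover have "e' \<in> (`) f ` edges G" if e': "e' \<in> edges H" for e'
  proof -
    obtain x y where "e' = {x, y}" "x \<in> f ` verts G" "y \<in> f ` verts G"
      using simple_graph_edgeE[OF assms(2) e'] img by metis
    then obtain u v where "e' = {f u, f v}" "u \<in> verts G" "v \<in> verts G"
      by auto
    then show ?thesis
      using adj e' by (intro image_eqI[of _ _ "{u, v}"]) auto
  qed
  ultimately have img': "(`) f ` edges G = edges H"
    by auto
  have "edge_adj e1 e2 \<longleftrightarrow> edge_adj (f ` e1) (f ` e2)" if "e1 \<in> edges G" "e2 \<in> edges G" for e1 e2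
  proof -
    \<comment> \<open>Taking images under a map injective on the vertices commutes with
      intersection, so sharing an endpoint is preserved and reflected.\<close>
    have "f ` e1 \<inter> f ` e2 = f ` (e1 \<inter> e2)"
      using inj_on_image_Int[OF inj] that sub by (metis Pow_iff subsetD)
    then show ?thesis
      using inj' that by (auto simp: edge_adj_def inj_on_eq_iff)
  qed
  then have "isomorphism ((`) f) (line_graph G) (line_graph H)"
    using inj' img' by (auto simp: isomorphism_def bij_betw_def edges_line_graph_iff)
  then show ?thesis
    by (auto simp: graph_iso_altdef)
qed

text \<open>Bridges the types: families, \<open>line_preimage\<close> and the hypothesis on perfect
  graphs concern graphs on \<open>nat\<close>, whereas \<open>G\<close> and its line graph have
  vertices of other types.\<close>

lemma ex_nat_copy:
  fixes G :: "'a ugraph"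
  assumes "simple_graph G"
  obtains H :: "nat ugraph"
  where "simple_graph H" "graph_iso G H" "iso_free G \<Longrightarrow> iso_free H"
proof -
  have "finite (verts G)"
    using assms by (simp add: simple_graph_def)
  then obtain f :: "'a \<Rightarrow> nat" where inj: "inj_on f (verts G)"
    using finite_imp_inj_to_nat_seg by metis
  define H where "H = UGraph (f ` verts G) ((`) f ` edges G)"
  have sub: "e \<subseteq> verts G" "card e = 2" if "e \<in> edges G" for e
    using assms that by (auto simp: simple_graph_def)
  have "card (f ` e) = 2" if "e \<in> edges G" for e
    using sub[OF that] inj by (simp add: card_image inj_on_subset)
  then have "simple_graph H"
    using assms sub by (auto simp: simple_graph_def H_def)
  moreover have "isomorphism f G H"
  proof -
    \<comment> \<open>Distinct subsets of the vertex set have distinct images, so relabelling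
      creates no edge between non-adjacent vertices.\<close>
    have "{u, v} = e" if "e \<in> edges G" "{f u, f v} = f ` e" "u \<in> verts G" "v \<in> verts G" for u v e
      using inj_onD[OF inj_on_image_Pow[OF inj], of "{u, v}" e] sub that by auto
    then have "{u, v} \<in> edges G \<longleftrightarrow> {f u, f v} \<in> edges H"
      if "u \<in> verts G" "v \<in> verts G" for u v
      using that by (auto simp: H_def intro: rev_image_eqI)
    then show ?thesis
      using inj by (simp add: isomorphism_def bij_betw_def H_def)
  qed
  moreover have "iso_free H" if "iso_free G"
    using that by (auto simp: iso_free_def H_def)
  ultimately show ?thesis
    using that by (auto simp: graph_iso_altdef)
qed

text \<open>A set \<open>D\<close> of edges of \<open>G\<close> spans at once an edge-induced
  subgraph of \<open>G\<close> and an induced subgraph of the line graph, and the latter is the line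
  graph of the former. Hence the same \<open>D\<close> witnesses both sides.\<close>

lemma contains_induced_line_graph_iff:
  fixes G :: "'a ugraph"
  assumes "simple_graph G"
  shows "(\<exists>M\<in>F. contains_induced (line_graph G) M) \<longleftrightarrow>
           (\<exists>H\<in>line_preimage F. contains_edge_induced G H)"
proof
  assume "\<exists>M\<in>F. contains_induced (line_graph G) M"
  then obtain M D where M: "M \<in> F" and D: "D \<subseteq> edges G"
    and iso: "graph_iso (line_graph (edge_induced_subgraph D)) M"
    by (auto simp: contains_induced_def line_graph_edge_induced_subgraph)
  have simple: "simple_graph (edge_induced_subgraph D)"
    using assms D by (rule simple_graph_edge_induced_subgraph)
  \<comment> \<open>Its vertices are by construction the endpoints of edges in \<open>D\<close>;
    this is what puts its copy on \<open>nat\<close> into \<open>line_preimage F\<close>.\<close>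
  have "iso_free (edge_induced_subgraph D)"
    by (auto simp: iso_free_def)
  with simple obtain H :: "nat ugraph" where H: "simple_graph H" "iso_free H"
    and copy: "graph_iso (edge_induced_subgraph D) H"
    using ex_nat_copy by metis
  have "graph_iso (line_graph H) M"
    using graph_iso_trans[OF graph_iso_sym[OF line_graph_iso[OF simple H(1) copy]] iso] .
  then have "H \<in> line_preimage F"
    using H M by (auto simp: line_preimage_def)
  then show "\<exists>H\<in>line_preimage F. contains_edge_induced G H"
    using D copy by (auto simp: contains_edge_induced_def)
next
  assume "\<exists>H\<in>line_preimage F. contains_edge_induced G H"
  then obtain H M :: "nat ugraph" and D where H: "simple_graph H" and M: "M \<in> F" "graph_iso (line_graph H) M"
    and D: "D \<subseteq> edges G" "graph_iso (edge_induced_subgraph D) H"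
    by (auto simp: line_preimage_def contains_edge_induced_def)
  have "graph_iso (line_graph (edge_induced_subgraph D)) M"
    using line_graph_iso[OF simple_graph_edge_induced_subgraph[OF assms D(1)] H D(2)] M(2)
    by (rule graph_iso_trans)
  then show "\<exists>M\<in>F. contains_induced (line_graph G) M"
    using M(1) D(1) by (auto simp: contains_induced_def line_graph_edge_induced_subgraph)
qed

section \<open>Beineke's graphs are not induced subgraphs of line graphs\<close>

text \<open>Pigeonhole: the two ends of \<open>e\<close> cannot serve three pairwise disjoint edges.
  Here \<open>e\<close> is the centre of the claw.\<close>

lemma no_claw:
  assumes "card e = 2"
    and "e \<inter> x \<noteq> {}" "e \<inter> y \<noteq> {}" "e \<inter> z \<noteq> {}"
    and "x \<inter> y = {}" "x \<inter> z = {}" "y \<inter> z = {}"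
  shows False
proof -
  obtain a b where "e = {a, b}"
    using assms(1) by (auto simp: card_2_iff)
  then show False
    using assms by auto
qed

text \<open>
  Three pairwise intersecting edges form a star or a triangle; any other edge meets an even
  number of the sides of a triangle. Oddness is expressed as exclusive or.
\<close>

lemma odd_triangle_is_star:
  assumes card: "card e1 = 2" "card e2 = 2" "card e3 = 2" "card x = 2"
    and distinct: "e1 \<noteq> e2" "e1 \<noteq> e3" "e2 \<noteq> e3" "x \<noteq> e1" "x \<noteq> e2" "x \<noteq> e3"
    and meet: "e1 \<inter> e2 \<noteq> {}" "e1 \<inter> e3 \<noteq> {}" "e2 \<inter> e3 \<noteq> {}"
    and odd: "(e1 \<inter> x \<noteq> {}) \<noteq> ((e2 \<inter> x \<noteq> {}) \<noteq> (e3 \<inter> x \<noteq> {}))"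
  shows "e1 \<inter> e2 \<inter> e3 \<noteq> {}"
proof
  assume empty: "e1 \<inter> e2 \<inter> e3 = {}"
  obtain c where c: "c \<in> e1" "c \<in> e2"
    using meet by auto
  obtain a where a: "e1 = {c, a}" "a \<noteq> c"
    using card(1) c by (auto simp: card_2_iff)
  obtain b where b: "e2 = {c, b}" "b \<noteq> c"
    using card(2) c by (auto simp: card_2_iff)
  \<comment> \<open>With no point common to all three edges, \<open>e3\<close> must join the other
    ends \<open>a\<close> and \<open>b\<close>, which closes a triangle.\<close>
  have "c \<notin> e3"
    using c empty by auto
  then have "a \<in> e3" "b \<in> e3" "a \<noteq> b"
    using meet a b distinct by auto
  then have e3: "e3 = {a, b}"
    using card(3) by (auto simp: card_2_iff)
  \<comment> \<open>Since \<open>x\<close> is not a side, it contains at most one of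
    \<open>a\<close>, \<open>b\<close>, \<open>c\<close>, and so meets none or exactly two of the
    sides.\<close>
  obtain p q where "x = {p, q}" "p \<noteq> q"
    using card(4) by (auto simp: card_2_iff)
  then show False
    using odd distinct a b e3 by (auto simp: doubleton_eq_iff)
qed

text \<open>By oddness both triangles of the diamond come from stars. Each star is centred at the
  only common point of \<open>e1\<close> and \<open>e2\<close>, so this point lies in both
  \<open>e3\<close> and \<open>e4\<close>, which are disjoint.\<close>

lemma no_diamond_with_odd_triangles:
  assumes card: "card e1 = 2" "card e2 = 2" "card e3 = 2" "card e4 = 2" "card x = 2" "card y = 2"
    and distinct: "e1 \<noteq> e2" "e1 \<noteq> e3" "e2 \<noteq> e3" "e1 \<noteq> e4" "e2 \<noteq> e4"
      "x \<noteq> e1" "x \<noteq> e2" "x \<noteq> e3" "y \<noteq> e1" "y \<noteq> e2" "y \<noteq> e4"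
    and meet: "e1 \<inter> e2 \<noteq> {}" "e1 \<inter> e3 \<noteq> {}" "e2 \<inter> e3 \<noteq> {}" "e1 \<inter> e4 \<noteq> {}" "e2 \<inter> e4 \<noteq> {}"
      "e3 \<inter> e4 = {}"
    and odd: "(e1 \<inter> x \<noteq> {}) \<noteq> ((e2 \<inter> x \<noteq> {}) \<noteq> (e3 \<inter> x \<noteq> {}))"
      "(e1 \<inter> y \<noteq> {}) \<noteq> ((e2 \<inter> y \<noteq> {}) \<noteq> (e4 \<inter> y \<noteq> {}))"
  shows False
proof -
  have "e1 \<inter> e2 \<inter> e3 \<noteq> {}"
    by (rule odd_triangle_is_star[where x = x]) (use assms in simp_all)
  moreover have "e1 \<inter> e2 \<inter> e4 \<noteq> {}"
    by (rule odd_triangle_is_star[where x = y]) (use assms in simp_all)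
  \<comment> \<open>Two distinct edges share at most one point, so the two star centres
    coincide.\<close>
  moreover have "u = v" if "u \<in> e1 \<inter> e2" "v \<in> e1 \<inter> e2" for u v
    using that card(1,2) distinct(1) by (auto simp: card_2_iff)
  ultimately show False
    using meet(6) by blast
qed

section \<open>Excluding the nine graphs\<close>

lemma verts_mk_graph [simp]: "verts (mk_graph n es) = {..<n}"
  by (simp add: mk_graph_def)

lemma edges_mk_graph_iff: "{i, j} \<in> edges (mk_graph n es) \<longleftrightarrow> (i, j) \<in> set es \<or> (j, i) \<in> set es"
  by (auto simp: mk_graph_def doubleton_eq_iff)

text \<open>Turns containment into a sequence of distinct two-element sets whose disjointness can be
  read off the list \<open>es\<close>; what remains is elementary set theory.\<close>

lemma contains_induced_line_graph_mk_graphE: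
  fixes H :: "'a ugraph"
  assumes "simple_graph H" and "contains_induced (line_graph H) (mk_graph n es)"
  obtains g :: "nat \<Rightarrow> 'a set" where "\<And>i. i < n \<Longrightarrow> card (g i) = 2"
    and "\<And>i j. i < n \<Longrightarrow> j < n \<Longrightarrow> g i = g j \<longleftrightarrow> i = j"
    and "\<And>i j. i < n \<Longrightarrow> j < n \<Longrightarrow> i \<noteq> j \<Longrightarrow>
           g i \<inter> g j = {} \<longleftrightarrow> (i, j) \<notin> set es \<and> (j, i) \<notin> set es"
proof -
  obtain S where S: "S \<subseteq> edges H"
    and "graph_iso (mk_graph n es) (induced_subgraph (line_graph H) S)"
    using assms(2) graph_iso_sym by (auto simp: contains_induced_def)
  then obtain g where "isomorphism g (mk_graph n es) (induced_subgraph (line_graph H) S)"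
    by (auto simp: graph_iso_altdef)
  then have inj: "inj_on g {..<n}" and img: "g ` {..<n} = S"
    and adj: "\<And>i j. i < n \<Longrightarrow> j < n \<Longrightarrow>
        {i, j} \<in> edges (mk_graph n es) \<longleftrightarrow> {g i, g j} \<in> edges (line_graph H) \<and> {g i, g j} \<subseteq> S"
    by (auto simp: isomorphism_def bij_betw_def)
  show ?thesis
  proof (rule that[of g])
    show "card (g i) = 2" if "i < n" for i
      using that img S assms(1) by (auto simp: simple_graph_def)
    show eq: "g i = g j \<longleftrightarrow> i = j" if "i < n" "j < n" for i j
      using that inj by (auto simp: inj_on_eq_iff)
    show "g i \<inter> g j = {} \<longleftrightarrow> (i, j) \<notin> set es \<and> (j, i) \<notin> set es"
      if "i < n" "j < n" "i \<noteq> j" for i j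
    proof -
      have "g i \<in> S" "g j \<in> S"
        using that img by auto
      then have "{i, j} \<in> edges (mk_graph n es) \<longleftrightarrow> edge_adj (g i) (g j)"
        using adj[OF that(1,2)] S by (auto simp: edges_line_graph_iff)
      then show ?thesis
        using eq[OF that(1,2)] that(3) by (auto simp: edges_mk_graph_iff edge_adj_def)
    qed
  qed
qed

text \<open>The diamond has the common edge \<open>a b\<close> and the tips \<open>c\<close> and
  \<open>d\<close>; \<open>x\<close> witnesses that the triangle \<open>a b c\<close> is odd, and
  \<open>y\<close> does so for \<open>a b d\<close>. For a concrete list all conditions can be
  evaluated. Each witness has to avoid only its own triangle, so \<open>x\<close> and
  \<open>y\<close> may coincide.\<close>

lemma line_graph_no_diamond_with_odd_triangles:
  fixes H :: "'a ugraph" and n :: nat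
  defines "adj \<equiv> \<lambda>es i j. (i, j) \<in> set es \<or> (j, i) \<in> set es"
  assumes "simple_graph H" and "contains_induced (line_graph H) (mk_graph n es)"
    and "{a, b, c, d, x, y} \<subseteq> {..<n}"
    and "distinct [a, b, c, d]" "x \<notin> {a, b, c}" "y \<notin> {a, b, d}"
    and "adj es a b" "adj es a c" "adj es b c" "adj es a d" "adj es b d" "\<not> adj es c d"
    and "adj es a x \<noteq> (adj es b x \<noteq> adj es c x)" "adj es a y \<noteq> (adj es b y \<noteq> adj es d y)"
  shows False
proof -
  obtain g :: "nat \<Rightarrow> 'a set" where "\<And>i. i < n \<Longrightarrow> card (g i) = 2"
    "\<And>i j. i < n \<Longrightarrow> j < n \<Longrightarrow> g i = g j \<longleftrightarrow> i = j"
    "\<And>i j. i < n \<Longrightarrow> j < n \<Longrightarrow> i \<noteq> j \<Longrightarrow>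
       g i \<inter> g j = {} \<longleftrightarrow> (i, j) \<notin> set es \<and> (j, i) \<notin> set es"
    by (rule contains_induced_line_graph_mk_graphE[OF assms(2,3)]) (rule that)
  then have "\<And>i. i < n \<Longrightarrow> card (g i) = 2"
    "\<And>i j. i < n \<Longrightarrow> j < n \<Longrightarrow> g i = g j \<longleftrightarrow> i = j"
    "\<And>i j. i < n \<Longrightarrow> j < n \<Longrightarrow> i \<noteq> j \<Longrightarrow> g i \<inter> g j = {} \<longleftrightarrow> \<not> adj es i j"
    by (simp_all add: adj_def)
  moreover have "a \<noteq> x" "b \<noteq> x" "c \<noteq> x" "a \<noteq> y" "b \<noteq> y" "d \<noteq> y"
    using assms(6,7) by auto
  ultimately show False
    by (intro no_diamond_with_odd_triangles[of "g a" "g b" "g c" "g d" "g x" "g y"])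
      (use assms(4-) in simp_all)
qed

text \<open>Apart from the claw, each of the nine graphs contains a diamond whose two triangles are
  both odd, so a single argument excludes eight of them.\<close>

lemma line_graph_beineke_free:
  fixes H :: "'a ugraph"
  assumes "simple_graph H" and "N \<in> beineke_graphs"
  shows "\<not> contains_induced (line_graph H) N"
proof
  assume con: "contains_induced (line_graph H) N"
  note diamond = line_graph_no_diamond_with_odd_triangles[OF assms(1)]
  consider
      "N = mk_graph 4 [(0,1), (0,2), (0,3)]"
    | "N = mk_graph 5 [(0,1), (0,2), (0,3), (0,4), (1,2), (1,3), (1,4), (2,3), (2,4)]"
    | "N = mk_graph 5 [(0,1), (0,2), (0,3), (1,2), (1,3), (2,4), (3,4)]"
    | "N = mk_graph 6 [(0,1), (0,2), (0,3), (1,2), (1,3), (2,4), (3,5)]"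
    | "N = mk_graph 6 [(0,1), (0,2), (0,3), (1,2), (1,3), (2,4), (3,5), (4,5)]"
    | "N = mk_graph 6 [(0,1), (0,2), (0,3), (0,4), (1,2), (1,3), (1,5), (2,4), (3,5)]"
    | "N = mk_graph 6 [(0,1), (0,2), (0,3), (0,4), (1,2), (1,3), (1,4), (2,3), (4,5)]"
    | "N = mk_graph 6
         [(0,1), (0,2), (0,3), (0,4), (0,5), (1,2), (1,3), (1,4), (1,5), (2,3), (4,5)]"
    | "N = mk_graph 6 [(0,1), (0,2), (0,3), (0,4), (0,5), (1,2), (1,3), (2,4), (3,5), (4,5)]"
    using assms(2) unfolding beineke_graphs_def insert_iff by fast
  then show False
  proof cases
    case 1
    obtain g :: "nat \<Rightarrow> 'a set" where "\<And>i. i < 4 \<Longrightarrow> card (g i) = 2"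
      "\<And>i j. i < 4 \<Longrightarrow> j < 4 \<Longrightarrow> g i = g j \<longleftrightarrow> i = j"
      "\<And>i j. i < 4 \<Longrightarrow> j < 4 \<Longrightarrow> i \<noteq> j \<Longrightarrow> g i \<inter> g j = {} \<longleftrightarrow>
         (i, j) \<notin> set [(0,1), (0,2), (0,3)] \<and> (j, i) \<notin> set [(0,1), (0,2), (0,3)]"
      by (rule contains_induced_line_graph_mk_graphE[OF assms(1) con[unfolded 1]]) (rule that)
    then show False
      by (intro no_claw[of "g 0" "g 1" "g 2" "g 3"]) simp_all
  next
    case 2
    \<comment> \<open>Vertex 2 is adjacent to all of 0, 1, 3, 4, so it sees three vertices of either
      triangle and is the witness for both.\<close>
    show False by (rule diamond[OF con[unfolded 2], of 0 1 3 4 2 2]) simp_all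
  next
    case 3
    show False by (rule diamond[OF con[unfolded 3], of 0 1 2 3 4 4]) simp_all
  next
    case 4
    show False by (rule diamond[OF con[unfolded 4], of 0 1 2 3 4 5]) simp_all
  next
    case 5
    show False by (rule diamond[OF con[unfolded 5], of 0 1 2 3 4 5]) simp_all
  next
    case 6
    \<comment> \<open>The witnesses are crossed: 4 sees two vertices of the triangle 0 1 2 but only
      one of 0 1 3, and for 5 it is the other way round. The wheel below behaves alike.\<close>
    show False by (rule diamond[OF con[unfolded 6], of 0 1 2 3 5 4]) simp_all
  next
    case 7
    show False by (rule diamond[OF con[unfolded 7], of 0 1 2 4 3 5]) simp_all
  next
    case 8
    show False by (rule diamond[OF con[unfolded 8], of 0 1 2 4 3 5]) simp_all
  next
    case 9
    show False by (rule diamond[OF con[unfolded 9], of 0 1 2 3 5 4]) simp_all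
  qed
qed

section \<open>Reduced families and the three equivalent conditions\<close>

lemma line_preimage_red: "line_preimage (red F) = line_preimage F"
proof -
  \<comment> \<open>A member of \<open>F\<close> that has a preimage is isomorphic to a line graph,
    hence free of the nine graphs. So the reduction discards only members without preimages.\<close>
  have "M \<in> red F" if "M \<in> F" "simple_graph H" "graph_iso (line_graph H) M" for H M :: "nat ugraph"
    using that line_graph_beineke_free contains_induced_iso[OF that(3)] by (auto simp: red_def)
  then show ?thesis
    by (auto simp: line_preimage_def red_def)
qed

theorem theorem28:
  fixes X :: player and Y :: "player option"
    and F :: "nat ugraph set" and G :: "'a ugraph"
  assumes "\<forall>M\<in>F. simple_graph M"
    and "\<forall>H :: nat ugraph. simple_graph H \<longrightarrow>
           (game_perfect X Y H \<longleftrightarrow> \<not> (\<exists>M\<in>F. contains_induced H M))"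
    and "simple_graph G"
  shows "(line_game_perfect X Y G \<longleftrightarrow>
            \<not> (\<exists>H\<in>line_preimage F. contains_edge_induced G H)) \<and>
         (\<not> (\<exists>H\<in>line_preimage F. contains_edge_induced G H) \<longleftrightarrow>
            \<not> (\<exists>H\<in>line_preimage (red F). contains_edge_induced G H))"
proof -
  \<comment> \<open>The characterisation by \<open>F\<close> is assumed for graphs on
    \<open>nat\<close>, so it is applied to a copy \<open>L\<close> of the line graph; perfectness
    and containment are then carried across the isomorphism.\<close>
  obtain L :: "nat ugraph" where L: "simple_graph L" "graph_iso (line_graph G) L"
    using ex_nat_copy[OF simple_graph_line_graph[OF assms(3)]] by metis
  have "line_game_perfect X Y G \<longleftrightarrow> game_perfect X Y L"
    using game_perfect_iso[OF L(2)] by (simp add: line_game_perfect_iff)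
  also have "\<dots> \<longleftrightarrow> \<not> (\<exists>M\<in>F. contains_induced (line_graph G) M)"
    using assms(2) L(1) contains_induced_iso[OF L(2), where M = M for M :: "nat ugraph"] by simp
  finally show ?thesis
    by (simp add: contains_induced_line_graph_iff[OF assms(3)] line_preimage_red)
qed

end
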